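(* A word $w\in\{a,b\}^+$ is unavoidable in the Prouhet-Thue-Morse sequence $\mathbf{t}$ if and only if $w$ is one of the words $a^2ba^2$ and $b^2ab^2$, or $w$ is a segment of $\mathbf{t}$.
   Context: Let $\{a,b\}^+$ be the free semigroup (nonempty finite words) on $\{a,b\}$. Let $\mu$ be the endomorphism of $\{a,b\}^+$ with $\mu(a)=ab$, $\mu(b)=ba$. The Prouhet-Thue-Morse sequence $\mathbf{t}$ is the infinite word over $\{a,b\}$ (indexed by the positive integers) whose prefix of length $2^n$ is $\mu^n(a)$ for every $n\ge 0$. A finite segment of an infinite word $a_1a_2\cdots$ is a word of the form $a_ka_{k+1}\cdots a_\ell$ with $k\le\ell$. A word $w\in\{a,b\}^+$ is unavoidable in $\mathbf{t}$ (is a pattern of $\mathbf{t}$) if there is a semigroup homomorphism $\varphi:\{a,b\}^+\to\{a,b\}^+$ (so images of letters are nonempty) such that $\varphi(w)$ is a segment of $\mathbf{t}$. *)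

theory Defs
  imports Main
begin

datatype letter = La | Lb

text \<open>The free semigroup on the two letters is the set of nonempty lists. Semigroup
  homomorphisms are functions on lists whose value at the empty list is irrelevant.\<close>

definition semigroup_hom :: "('a list \<Rightarrow> 'b list) \<Rightarrow> bool" where
  "semigroup_hom \<phi> \<longleftrightarrow>
     (\<forall>u. u \<noteq> [] \<longrightarrow> \<phi> u \<noteq> []) \<and>
     (\<forall>u v. u \<noteq> [] \<longrightarrow> v \<noteq> [] \<longrightarrow> \<phi> (u @ v) = \<phi> u @ \<phi> v)"

fun mu_letter :: "letter \<Rightarrow> letter list" where
  "mu_letter La = [La, Lb]"
| "mu_letter Lb = [Lb, La]"

definition mu :: "letter list \<Rightarrow> letter list" where
  "mu w = concat (map mu_letter w)"

lemma mu_simps [simp]: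
  "mu [] = []" "mu (x # w) = mu_letter x @ mu w" "mu (u @ v) = mu u @ mu v"
  by (simp_all add: mu_def)

lemma semigroup_hom_mu: "semigroup_hom mu"
proof -
  have "mu_letter x \<noteq> []" for x by (cases x) auto
  then have "mu u \<noteq> []" if "u \<noteq> []" for u using that by (cases u) auto
  then show ?thesis by (simp add: semigroup_hom_def)
qed

text \<open>An infinite word over \<open>'a\<close> is a function \<open>nat \<Rightarrow> 'a\<close> that is only ever inspected
  at positive arguments.\<close>

definition segment :: "'a list \<Rightarrow> (nat \<Rightarrow> 'a) \<Rightarrow> bool" where
  "segment w s \<longleftrightarrow> (\<exists>k l. 1 \<le> k \<and> k \<le> l \<and> w = map s [k..<Suc l])"

definition prefix_word :: "(nat \<Rightarrow> 'a) \<Rightarrow> nat \<Rightarrow> 'a list" where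
  "prefix_word s n = map s [1..<Suc n]"

text \<open>Since \<open>i \<le> 2 ^ i\<close>, the \<open>i\<close>-th letter can be read off the prefix of length \<open>2 ^ i\<close>.
  The lemmas \<open>prefix_thue_morse\<close> and \<open>thue_morse_unique\<close> below show that this is the
  word defined by its prefixes.\<close>

definition thue_morse :: "nat \<Rightarrow> letter" where
  "thue_morse i = ((mu ^^ i) [La]) ! (i - 1)"

definition unavoidable :: "letter list \<Rightarrow> (nat \<Rightarrow> letter) \<Rightarrow> bool" where
  "unavoidable w s \<longleftrightarrow>
     (\<exists>\<phi> :: letter list \<Rightarrow> letter list. semigroup_hom \<phi> \<and> segment (\<phi> w) s)"

lemma length_mu: "length (mu w) = 2 * length w"
proof (induction w)
  case (Cons x w)
  then show ?case by (cases x) auto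
qed simp

lemma length_mu_power: "length ((mu ^^ n) w) = 2 ^ n * length w"
  by (induction n) (auto simp: length_mu)

lemma mu_power_append: "(mu ^^ n) (u @ v) = (mu ^^ n) u @ (mu ^^ n) v"
  by (induction n) auto

lemma mu_power_nth_Suc:
  assumes "j < 2 ^ n"
  shows "((mu ^^ Suc n) [La]) ! j = ((mu ^^ n) [La]) ! j"
proof -
  have "(mu ^^ Suc n) [La] = (mu ^^ n) ([La] @ [Lb])"
    unfolding funpow_Suc_right by simp
  then show ?thesis
    using assms by (simp only: mu_power_append nth_append length_mu_power) simp
qed

lemma mu_power_nth:
  assumes "j < 2 ^ n" "n \<le> m"
  shows "((mu ^^ m) [La]) ! j = ((mu ^^ n) [La]) ! j"
  using assms(2)
proof (induction m rule: dec_induct)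
  case (step m)
  have "j < 2 ^ m"
    using assms(1) step(1) power_increasing[of n m "2::nat"] by linarith
  then show ?case using step mu_power_nth_Suc by metis
qed simp

lemma prefix_thue_morse: "prefix_word thue_morse (2 ^ n) = (mu ^^ n) [La]"
proof (rule nth_equalityI)
  show "length (prefix_word thue_morse (2 ^ n)) = length ((mu ^^ n) [La])"
    by (simp add: prefix_word_def length_mu_power)
next
  fix j assume "j < length (prefix_word thue_morse (2 ^ n))"
  then have j: "j < 2 ^ n" by (simp add: prefix_word_def)
  have j': "j < 2 ^ Suc j" using less_exp[of "Suc j"] by linarith
  have "prefix_word thue_morse (2 ^ n) ! j = thue_morse (Suc j)"
    using j by (simp add: prefix_word_def del: upt_Suc)
  also have "\<dots> = ((mu ^^ Suc j) [La]) ! j"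
    by (simp only: thue_morse_def diff_Suc_1)
  also have "\<dots> = ((mu ^^ n) [La]) ! j"
    using mu_power_nth[OF j, of "Suc j"] mu_power_nth[OF j', of n] nat_le_linear[of n "Suc j"] by metis
  finally show "prefix_word thue_morse (2 ^ n) ! j = (mu ^^ n) [La] ! j" .
qed

lemma thue_morse_unique:
  assumes "\<And>n. prefix_word s (2 ^ n) = (mu ^^ n) [La]" "1 \<le> i"
  shows "s i = thue_morse i"
proof -
  have "i \<le> 2 ^ i" using less_exp[of i] by linarith
  moreover have "prefix_word s (2 ^ i) = prefix_word thue_morse (2 ^ i)"
    by (simp only: assms(1) prefix_thue_morse)
  ultimately show ?thesis
    using assms(2) by (simp add: prefix_word_def less_Suc_eq_le del: upt_Suc)
qed

end

(* Suppose phi(w) occurs in t. If both letter images have even length, then t can be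
   desubstituted along mu and the images halved, so one image may be assumed to have odd length.
   A word of length at least 5 occurs in t only at positions of one parity, because equal adjacent
   letters occur at odd 0-based positions only. If w contains aa, bb, aba and bab, this bounds both
   images by length 4, and a finite check for overlaps leaves only the two bijective renamings of
   the letters, so that w occurs in t. The remaining overlap-free words w have length at most 10
   unless they contain one of six squares such as aabaab; phi of such a square cannot occur in t,
   since t has no letter left with which to extend it without creating an overlap. *)

theory Submission
  imports Defs "HOL-Library.Sublist"
begin

section \<open>Exchange of the letters and the recurrences of the Thue-Morse word\<close>

fun flip :: "letter \<Rightarrow> letter" where
  "flip La = Lb"
| "flip Lb = La"

lemma flip_neq [simp]: "flip x \<noteq> x" "x \<noteq> flip x"
  by (cases x; simp)+

lemma flip_flip [simp]: "flip (flip x) = x"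
  by (cases x) auto

lemma flip_eq_iff [simp]: "flip x = flip y \<longleftrightarrow> x = y"
  by (cases x; cases y) auto

lemma neq_imp_flip: "x \<noteq> y \<Longrightarrow> x = flip y"
  by (cases x; cases y) auto

text \<open>Counting positions from 0 makes \<open>mu\<close> act on them by doubling, so that
  parities can be compared.\<close>

definition tm :: "nat \<Rightarrow> letter" where
  "tm i = thue_morse (Suc i)"

lemma mu_nth: "j < length u \<Longrightarrow> mu u ! (2 * j) = u ! j \<and> mu u ! Suc (2 * j) = flip (u ! j)"
proof (induction u arbitrary: j)
  case (Cons x u)
  then show ?case by (cases x; cases j) auto
qed simp

lemma tm_mu_power:
  assumes "j < 2 ^ n"
  shows "tm j = (mu ^^ n) [La] ! j"
proof -
  have "prefix_word thue_morse (2 ^ n) ! j = tm j"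
    using assms by (simp add: prefix_word_def tm_def del: upt_Suc)
  then show ?thesis by (simp only: prefix_thue_morse)
qed

text \<open>Both positions lie in the prefix of length \<open>2 ^ Suc i\<close>, which is
  \<open>mu\<close> applied to the prefix of length \<open>2 ^ i\<close>, and \<open>i\<close> lies
  in the latter.\<close>

lemma tm_double [simp]: "tm (2 * i) = tm i" "tm (Suc (2 * i)) = flip (tm i)"
proof -
  have i: "i < 2 ^ i" by simp
  have i1: "2 * i < 2 ^ Suc i" "Suc (2 * i) < 2 ^ Suc i"
    unfolding power_Suc using less_exp[of i] by linarith+
  have "i < length ((mu ^^ i) [La])" by (simp add: length_mu_power)
  from mu_nth[OF this]
  show "tm (2 * i) = tm i" "tm (Suc (2 * i)) = flip (tm i)"
    by (simp_all only: tm_mu_power[OF i] tm_mu_power[OF i1(1)] tm_mu_power[OF i1(2)]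
        funpow.simps comp_apply)
qed

section \<open>Equal neighbours and overlap-freeness\<close>

lemma tm_Suc_eq_imp_odd: "tm i = tm (Suc i) \<Longrightarrow> odd i"
  by (auto elim!: evenE)

text \<open>If five consecutive letters alternated, those at distances 0, 2 and 4 would be equal.
  Halving positions turns them into three equal consecutive letters, so equal pairs would start at
  two adjacent positions, one of them even.\<close>

lemma ex_repeat_tm: "\<exists>j\<le>3. tm (i + j) = tm (Suc (i + j))"
proof (rule ccontr)
  assume "\<not> ?thesis"
  then have *: "tm (i + j) = flip (tm (Suc (i + j)))" if "j \<le> 3" for j
    using that neq_imp_flip by blast
  have alt: "tm i = tm (i + 2)" "tm (i + 2) = tm (i + 4)" "tm (Suc i) = flip (tm i)"
    using *[of 0] *[of 1] *[of 2] *[of 3] by (simp_all add: numeral_eq_Suc)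
  define k where "k = i div 2"
  have "tm k = tm (Suc k) \<and> tm (Suc k) = tm (Suc (Suc k))"
  proof (cases "even i")
    case True
    then have "i = 2 * k" "i + 2 = 2 * Suc k" "i + 4 = 2 * Suc (Suc k)"
      by (auto simp: k_def)
    then show ?thesis using alt(1,2) by (metis tm_double(1))
  next
    case False
    then have "i = Suc (2 * k)" "i + 2 = Suc (2 * Suc k)" "i + 4 = Suc (2 * Suc (Suc k))"
      by (auto simp: k_def)
    then show ?thesis using alt(1,2) by (metis tm_double(2) flip_eq_iff)
  qed
  then show False
    using tm_Suc_eq_imp_odd[of k] tm_Suc_eq_imp_odd[of "Suc k"] by auto
qed

text \<open>An even period is halved along \<open>mu\<close>. With an odd period, a pair of equal
  neighbours would recur at a position of the other parity, so the whole overlap alternates, against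
  \<open>ex_repeat_tm\<close>.\<close>

lemma tm_no_overlap:
  assumes "0 < p" "\<And>j. j \<le> p \<Longrightarrow> tm (i + j) = tm (i + j + p)"
  shows False
  using assms
proof (induction p arbitrary: i rule: less_induct)
  case (less p)
  show False
  proof (cases "even p")
    case True
    then obtain q where q: "p = 2 * q" by (elim evenE)
    have "tm (i div 2 + j) = tm (i div 2 + j + q)" if "j \<le> q" for j
    proof (cases "even i")
      case True
      then have "i + 2 * j = 2 * (i div 2 + j)" "i + 2 * j + p = 2 * (i div 2 + j + q)"
        using q by auto
      then show ?thesis using less.prems(2)[of "2 * j"] that q by (metis mult_le_mono2 tm_double(1))
    next
      case False
      then have "i + 2 * j = Suc (2 * (i div 2 + j))" "i + 2 * j + p = Suc (2 * (i div 2 + j + q))"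
        using q by auto
      then show ?thesis using less.prems(2)[of "2 * j"] that q
        by (metis mult_le_mono2 tm_double(2) flip_eq_iff)
    qed
    then show False using less.IH[of q "i div 2"] less.prems(1) q by simp
  next
    case False
    have no: "tm (i + j) \<noteq> tm (Suc (i + j))" if "j < p" for j
    proof
      assume eq: "tm (i + j) = tm (Suc (i + j))"
      then have "tm (i + j + p) = tm (Suc (i + j + p))"
        using less.prems(2)[of j] less.prems(2)[of "Suc j"] that by simp
      then show False
        using tm_Suc_eq_imp_odd[OF eq] tm_Suc_eq_imp_odd[of "i + j + p"] False by simp
    qed
    have no': "tm (i + j + p) \<noteq> tm (Suc (i + j + p))" if "j < p" for j
      using no[OF that] less.prems(2)[of j] less.prems(2)[of "Suc j"] that by simp
    obtain j where j: "j \<le> 3" "tm (i + j) = tm (Suc (i + j))" using ex_repeat_tm by blast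
    \<comment> \<open>An odd \<open>p\<close> other than 1 is at least 3, so the repeat lies within
      the \<open>2 * p\<close> neighbouring pairs of the overlap.\<close>
    have "j < 2 * p \<or> p = 1" using j False by (cases "p \<le> 2") (auto simp: le_Suc_eq numeral_eq_Suc)
    then show False
    proof
      assume "j < 2 * p"
      then have "j < p \<or> j - p < p \<and> i + (j - p) + p = i + j" by auto
      then show False using no[of j] no'[of "j - p"] j(2) by auto
    next
      assume "p = 1"
      then have "tm i = tm (Suc i)" "tm (Suc i) = tm (Suc (Suc i))"
        using less.prems(2)[of 0] less.prems(2)[of 1] by simp_all
      then show False using tm_Suc_eq_imp_odd[of i] tm_Suc_eq_imp_odd[of "Suc i"] by simp
    qed
  qed
qed

text \<open>Every segment lies in some prefix of length \<open>2 ^ m\<close>, so this yields its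
  complement one block later.\<close>

lemma tm_add_power: "j < 2 ^ m \<Longrightarrow> tm (2 ^ m + j) = flip (tm j)"
proof (induction m arbitrary: j)
  case 0
  then show ?case using tm_double(2)[of 0] by simp
next
  case (Suc m)
  then have IH: "tm (2 ^ m + j div 2) = flip (tm (j div 2))" by (simp add: less_mult_imp_div_less)
  show ?case
  proof (cases "even j")
    case True
    then have "j = 2 * (j div 2)" "2 ^ Suc m + j = 2 * (2 ^ m + j div 2)" by auto
    then show ?thesis using IH by (metis tm_double(1))
  next
    case False
    then have "j = Suc (2 * (j div 2))" "2 ^ Suc m + j = Suc (2 * (2 ^ m + j div 2))" by auto
    then show ?thesis using IH by (metis tm_double(2))
  qed
qed

section \<open>Occurrences of finite words and their extensions\<close>

definition occurs_at :: "nat \<Rightarrow> letter list \<Rightarrow> bool" where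
  "occurs_at i u \<longleftrightarrow> (\<forall>j<length u. tm (i + j) = u ! j)"

lemma occurs_at_Nil [simp]: "occurs_at i []"
  by (simp add: occurs_at_def)

lemma occurs_at_Cons: "occurs_at i (x # u) \<longleftrightarrow> tm i = x \<and> occurs_at (Suc i) u"
  by (auto simp: occurs_at_def nth_Cons All_less_Suc2 split: nat.splits)

lemma occurs_at_append:
  "occurs_at i (u @ v) \<longleftrightarrow> occurs_at i u \<and> occurs_at (i + length u) v"
  by (induction u arbitrary: i) (auto simp: occurs_at_Cons)

lemma segment_iff_occurs_at:
  "segment w thue_morse \<longleftrightarrow> w \<noteq> [] \<and> (\<exists>i. occurs_at i w)"
proof
  assume "segment w thue_morse"
  then obtain k l where kl: "1 \<le> k" "k \<le> l" "w = map thue_morse [k..<Suc l]"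
    by (auto simp: segment_def)
  have "occurs_at (k - 1) w"
    using kl by (auto simp: occurs_at_def tm_def nth_append simp del: upt_Suc)
  then show "w \<noteq> [] \<and> (\<exists>i. occurs_at i w)" using kl by auto
next
  assume "w \<noteq> [] \<and> (\<exists>i. occurs_at i w)"
  then obtain i where i: "w \<noteq> []" "occurs_at i w" by blast
  have "w = map thue_morse [Suc i..<Suc (i + length w)]"
    using i(2) by (intro nth_equalityI) (auto simp: occurs_at_def tm_def simp del: upt_Suc)
  moreover have "Suc i \<le> i + length w" using i(1) by (cases w) auto
  ultimately show "segment w thue_morse"
    unfolding segment_def by (metis One_nat_def Suc_le_mono le0)
qed

lemma occurs_at_flip:
  assumes "occurs_at i u"
  obtains i' where "0 < i'" "occurs_at i' (map flip u)"
proof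
  define m where "m = i + length u"
  have "tm (2 ^ m + (i + j)) = flip (tm (i + j))" if "j < length u" for j
    by (rule tm_add_power) (use that less_exp[of m] m_def in linarith)
  then show "occurs_at (2 ^ m + i) (map flip u)"
    using assms by (simp add: occurs_at_def add.assoc)
qed simp

text \<open>Complementing twice restores the word and moves it off position 0, which leaves room for
  a letter on its left.\<close>

lemma occurs_at_pos:
  assumes "occurs_at i u"
  obtains i' where "0 < i'" "occurs_at i' u"
proof -
  obtain k where "occurs_at k (map flip u)" using occurs_at_flip[OF assms] by blast
  then obtain l where "0 < l" "occurs_at l (map flip (map flip u))" by (rule occurs_at_flip)
  then show thesis using that by (simp add: comp_def)
qed

lemma occurs_at_extend_left:
  assumes "occurs_at i u"
  obtains c i' where "occurs_at i' (c # u)"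
proof -
  obtain k where "0 < k" "occurs_at k u" using occurs_at_pos[OF assms] by blast
  then have "occurs_at (k - 1) (tm (k - 1) # u)" by (simp add: occurs_at_Cons)
  then show thesis by (rule that)
qed

lemma occurs_at_extend_right:
  assumes "occurs_at i u"
  obtains c where "occurs_at i (u @ [c])"
  using assms that by (simp add: occurs_at_append occurs_at_Cons)

lemma square_extend_right:
  assumes "occurs_at i (x @ x @ y)" "x \<noteq> []" "y \<noteq> []"
  shows "hd y \<noteq> hd x"
proof
  assume c: "hd y = hd x"
  have *: "tm (i + j) = (x @ x @ y) ! j" if "j \<le> 2 * length x" for j
    using assms that by (cases y) (auto simp: occurs_at_def)
  have "tm (i + j) = tm (i + j + length x)" if "j \<le> length x" for j
    using *[of j] *[of "j + length x"] that c assms(2,3)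
    by (auto simp: nth_append hd_conv_nth add.assoc)
  then show False using tm_no_overlap[of "length x" i] assms(2) by simp
qed

lemma square_extend_left:
  assumes "occurs_at i (y @ x @ x)" "x \<noteq> []" "y \<noteq> []"
  shows "last y \<noteq> last x"
proof
  assume c: "last y = last x"
  \<comment> \<open>Rotating \<open>x\<close> by one letter turns the preceding letter and
    \<open>x @ x\<close> into \<open>z @ z\<close> followed by the same letter, which is the
    right-hand case.\<close>
  define z where "z = last x # butlast x"
  have "x @ x = butlast x @ last x # butlast x @ [last x]"
    using assms(2) by (metis append.assoc append_Cons append_Nil append_butlast_last_id)
  then have "y @ x @ x = butlast y @ z @ z @ [last x]"
    using c assms(2,3) append_butlast_last_id[of y] by (simp add: z_def)
  then have "occurs_at (i + length (butlast y)) (z @ z @ [last x])"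
    using assms(1) by (simp only: occurs_at_append)
  from square_extend_right[OF this] show False by (simp add: z_def)
qed

text \<open>Five letters have four neighbouring pairs, just enough for \<open>ex_repeat_tm\<close>
  to find equal neighbours; they must start at an odd position in both occurrences.\<close>

lemma occurs_at_parity:
  assumes "occurs_at p u" "occurs_at q u" "5 \<le> length u"
  shows "even p \<longleftrightarrow> even q"
proof -
  obtain j where j: "j \<le> 3" "tm (p + j) = tm (Suc (p + j))" using ex_repeat_tm by blast
  then have "u ! j = u ! Suc j" using assms(1,3) by (simp add: occurs_at_def flip: add_Suc_right)
  then have "tm (q + j) = tm (Suc (q + j))"
    using assms(2,3) j(1) by (simp add: occurs_at_def flip: add_Suc_right)
  then show ?thesis
    using tm_Suc_eq_imp_odd[OF j(2)] tm_Suc_eq_imp_odd[of "q + j"] by auto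
qed

section \<open>Desubstitution along \<open>mu\<close>\<close>

text \<open>The even-indexed letters of \<open>u\<close> determine the \<open>mu\<close>-preimage: directly if \<open>u\<close> occurs
  at an even position, and complemented if it occurs at an odd one.\<close>

definition half :: "bool \<Rightarrow> letter list \<Rightarrow> letter list" where
  "half b u = map (\<lambda>j. if b then u ! (2 * j) else flip (u ! (2 * j))) [0..<length u div 2]"

lemma length_half [simp]: "length (half b u) = length u div 2"
  by (simp add: half_def)

lemma occurs_at_half:
  assumes "occurs_at i u"
  shows "occurs_at (i div 2) (half (even i) u)"
proof -
  have "tm (i div 2 + j) = (if even i then tm (i + 2 * j) else flip (tm (i + 2 * j)))" for j
  proof (cases "even i")
    case True
    then have "i + 2 * j = 2 * (i div 2 + j)" by auto
    with True show ?thesis by (metis tm_double(1))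
  next
    case False
    then have "i + 2 * j = Suc (2 * (i div 2 + j))" by auto
    with False show ?thesis by (metis tm_double(2) flip_flip)
  qed
  then show ?thesis using assms by (auto simp: occurs_at_def half_def)
qed

text \<open>Since all images have even length, all blocks start at positions of the same parity, and
  one flag serves them all.\<close>

lemma occurs_at_concat_half:
  assumes "\<And>c. even (length (f c))" "occurs_at i (concat (map f w))"
  shows "occurs_at (i div 2) (concat (map (\<lambda>c. half (even i) (f c)) w))"
  using assms(2)
proof (induction w arbitrary: i)
  case (Cons c w)
  have "occurs_at i (f c)" and *: "occurs_at (i + length (f c)) (concat (map f w))"
    using Cons.prems by (auto simp: occurs_at_append)
  moreover have "(i + length (f c)) div 2 = i div 2 + length (f c) div 2"
    using assms(1) by (simp add: div_plus_div_distrib_dvd_right)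
  ultimately show ?case
    using Cons.IH[OF *] assms(1) by (simp add: occurs_at_append occurs_at_half)
qed simp

section \<open>Homomorphisms given by letter images\<close>

definition is_instance :: "(letter \<Rightarrow> letter list) \<Rightarrow> letter list \<Rightarrow> bool" where
  "is_instance f w \<longleftrightarrow> (\<forall>c. f c \<noteq> []) \<and> (\<exists>i. occurs_at i (concat (map f w)))"

lemma is_instance_sublist: "is_instance f w \<Longrightarrow> sublist v w \<Longrightarrow> is_instance f v"
  by (auto simp: is_instance_def sublist_def occurs_at_append)

lemma hom_eq_concat:
  assumes "semigroup_hom \<phi>"
  shows "w \<noteq> [] \<Longrightarrow> \<phi> w = concat (map (\<lambda>c. \<phi> [c]) w)"
proof (induction w)
  case (Cons c w)
  then show ?case
    using assms unfolding semigroup_hom_def by (cases "w = []") (auto dest: spec[of _ "[c]"])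
qed simp

lemma unavoidable_iff:
  assumes "w \<noteq> []"
  shows "unavoidable w thue_morse \<longleftrightarrow> (\<exists>f. is_instance f w)"
proof
  assume "unavoidable w thue_morse"
  then obtain \<phi> where \<phi>: "semigroup_hom \<phi>" "segment (\<phi> w) thue_morse"
    by (auto simp: unavoidable_def)
  have "is_instance (\<lambda>c. \<phi> [c]) w"
    using \<phi> hom_eq_concat[OF \<phi>(1) assms]
    by (auto simp: is_instance_def segment_iff_occurs_at semigroup_hom_def)
  then show "\<exists>f. is_instance f w" by blast
next
  assume "\<exists>f. is_instance f w"
  then obtain f where f: "is_instance f w" by blast
  have "semigroup_hom (\<lambda>u. concat (map f u))"
    using f by (auto simp: semigroup_hom_def is_instance_def neq_Nil_conv)
  moreover have "concat (map f w) \<noteq> []"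
    using f assms by (auto simp: is_instance_def neq_Nil_conv)
  ultimately show "unavoidable w thue_morse"
    using f by (auto simp: unavoidable_def is_instance_def segment_iff_occurs_at)
qed

text \<open>Descent: halving two images of even length gives strictly shorter images of the same
  word, still nonempty because a positive even length is at least 2.\<close>

lemma instance_odd:
  assumes "is_instance f w"
  obtains g where "is_instance g w" "\<exists>c. odd (length (g c))"
  using assms
proof (induction "length (f La)" arbitrary: f thesis rule: less_induct)
  case less
  show ?case
  proof (cases "\<exists>c. odd (length (f c))")
    case True
    then show ?thesis using less.prems by blast
  next
    case False
    obtain i where i: "occurs_at i (concat (map f w))"
      using less.prems(2) by (auto simp: is_instance_def)
    define g where "g c = half (even i) (f c)" for c
    have pos: "f c \<noteq> []" "even (length (f c))" for c
      using less.prems(2) False by (auto simp: is_instance_def)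
    have len: "0 < length (g c) \<and> length (g c) < length (f c)" for c
    proof -
      have "0 < length (f c)" using pos(1) by simp
      then show ?thesis unfolding g_def length_half using pos(2)[of c] by presburger
    qed
    then have "g c \<noteq> []" for c by (metis length_greater_0_conv)
    then have "is_instance g w"
      using occurs_at_concat_half[OF pos(2) i] by (auto simp: is_instance_def g_def[abs_def])
    then show ?thesis using less.hyps[of g] len less.prems(1) by blast
  qed
qed

section \<open>Overlap-freeness as an executable test\<close>

definition overlap_prefix :: "letter list \<Rightarrow> bool" where
  "overlap_prefix w \<longleftrightarrow>
     (\<exists>p\<in>set [1..<length w]. 2 * p < length w \<and> take (Suc p) (drop p w) = take (Suc p) w)"

fun overlap_free :: "letter list \<Rightarrow> bool" where
  "overlap_free [] \<longleftrightarrow> True"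
| "overlap_free (x # w) \<longleftrightarrow> \<not> overlap_prefix (x # w) \<and> overlap_free w"

lemma overlap_prefixE:
  assumes "overlap_prefix w"
  obtains x v where "x \<noteq> []" "w = x @ x @ hd x # v"
proof -
  obtain p where p: "1 \<le> p" "2 * p < length w" "take (Suc p) (drop p w) = take (Suc p) w"
    using assms by (auto simp: overlap_prefix_def)
  define x where "x = take p w"
  have x: "x \<noteq> []" "length x = p" using p by (auto simp: x_def)
  have "w = x @ drop p w" by (simp add: x_def)
  also have "drop p w = take (Suc p) (drop p w) @ drop (Suc p) (drop p w)"
    by (rule append_take_drop_id[symmetric])
  also have "take (Suc p) (drop p w) = x @ [w ! p]"
    using p by (simp add: x_def take_Suc_conv_app_nth)
  also have "w ! p = hd x"
  proof -
    have "w ! p = take (Suc p) (drop p w) ! 0" using p(2) by simp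
    also have "\<dots> = w ! 0" by (simp only: p(3)) simp
    also have "\<dots> = hd x" using p by (cases w) (auto simp: x_def hd_conv_nth)
    finally show ?thesis .
  qed
  finally show thesis using that x(1) by simp
qed

text \<open>The image of an overlap contains a square followed by the first letter of the image of
  \<open>hd x\<close>, which is also the first letter of the square.\<close>

lemma instance_not_overlap_prefix:
  assumes "is_instance f w"
  shows "\<not> overlap_prefix w"
proof
  assume "overlap_prefix w"
  then obtain x v where x: "x \<noteq> []" "w = x @ x @ hd x # v" by (rule overlap_prefixE)
  obtain i where i: "occurs_at i (concat (map f w))" using assms by (auto simp: is_instance_def)
  have ne: "f c \<noteq> []" for c using assms by (simp add: is_instance_def)
  define y where "y = concat (map f x)"
  have y: "y \<noteq> []" "hd y = hd (f (hd x))" using x(1) ne by (auto simp: y_def neq_Nil_conv)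
  have "f (hd x) = hd y # tl (f (hd x))" using y ne by simp
  then have "concat (map f w) = (y @ y @ [hd y]) @ (tl (f (hd x)) @ concat (map f v))"
    using x(2) by (simp add: y_def)
  then have "occurs_at i (y @ y @ [hd y])" using i by (simp only: occurs_at_append)
  then show False using square_extend_right[of i y "[hd y]"] y(1) by simp
qed

lemma instance_overlap_free: "is_instance f w \<Longrightarrow> overlap_free w"
proof (induction w)
  case (Cons c w)
  have "is_instance f w" by (rule is_instance_sublist[OF Cons.prems]) (simp add: sublist_Cons_right)
  then show ?case using Cons instance_not_overlap_prefix by simp
qed simp

lemma occurs_at_overlap_free: "occurs_at i u \<Longrightarrow> overlap_free u"
  by (rule instance_overlap_free[of "\<lambda>c. [c]"]) (auto simp: is_instance_def)

section \<open>Squares that have no instance\<close>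

lemma letter_pigeonhole: "a \<noteq> b \<Longrightarrow> b \<noteq> c \<Longrightarrow> a = (c :: letter)"
  by (cases a; cases b; cases c) auto

text \<open>Put a letter \<open>c\<close> in front. Before \<open>x @ x\<close>, both
  \<open>c\<close> and the last letter of \<open>y\<close> differ from the last letter of
  \<open>x\<close>, so they agree; the square of \<open>x @ x @ y\<close> forbids this.\<close>

lemma no_xxyxxy:
  assumes "occurs_at i (x @ x @ y @ x @ x @ y)" "x \<noteq> []" "y \<noteq> []"
  shows False
proof -
  obtain c k where k: "occurs_at k (c # x @ x @ y @ x @ x @ y)"
    by (rule occurs_at_extend_left[OF assms(1)])
  have "\<exists>k. occurs_at k ([c] @ x @ x)" "\<exists>k. occurs_at k (y @ x @ x)"
    "\<exists>k. occurs_at k ([c] @ (x @ x @ y) @ (x @ x @ y))"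
    using k by (auto simp: occurs_at_append occurs_at_Cons)
  then have "c \<noteq> last x" "last y \<noteq> last x" "c \<noteq> last (x @ x @ y)"
    using square_extend_left assms(2,3)
    by (metis last.simps not_Cons_self2 append_is_Nil_conv)+
  then show False using letter_pigeonhole assms(3) by (metis last_append append_is_Nil_conv)
qed

text \<open>The mirror image of the previous argument, with the new letter on the right.\<close>

lemma no_yxxyxx:
  assumes "occurs_at i (y @ x @ x @ y @ x @ x)" "x \<noteq> []" "y \<noteq> []"
  shows False
proof -
  obtain c where k: "occurs_at i (y @ x @ x @ y @ x @ x @ [c])"
    using occurs_at_extend_right[OF assms(1)] by auto
  have "\<exists>k. occurs_at k (x @ x @ [c])" "\<exists>k. occurs_at k (x @ x @ y)"
    "\<exists>k. occurs_at k ((y @ x @ x) @ (y @ x @ x) @ [c])"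
    using k by (auto simp: occurs_at_append)
  then have "c \<noteq> hd x" "hd y \<noteq> hd x" "c \<noteq> hd (y @ x @ x)"
    using square_extend_right assms(2,3)
    by (metis list.sel(1) not_Cons_self2 append_is_Nil_conv)+
  then show False using letter_pigeonhole assms(3) by (metis hd_append2)
qed

text \<open>After \<open>y @ y\<close> the new letter must differ from the first letter of
  \<open>y\<close>, hence equal that of \<open>x\<close>; the square of \<open>x @ x @ y @ y\<close>
  forbids this.\<close>

lemma no_xxyyxxyy:
  assumes "occurs_at i (x @ x @ y @ y @ x @ x @ y @ y)" "x \<noteq> []" "y \<noteq> []"
  shows False
proof -
  obtain c where k: "occurs_at i (x @ x @ y @ y @ x @ x @ y @ y @ [c])"
    using occurs_at_extend_right[OF assms(1)] by auto
  have "\<exists>k. occurs_at k (y @ y @ [c])" "\<exists>k. occurs_at k (x @ x @ y)"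
    "\<exists>k. occurs_at k ((x @ x @ y @ y) @ (x @ x @ y @ y) @ [c])"
    using k by (auto simp: occurs_at_append)
  then have "c \<noteq> hd y" "hd y \<noteq> hd x" "c \<noteq> hd (x @ x @ y @ y)"
    using square_extend_right assms(2,3)
    by (metis list.sel(1) not_Cons_self2 append_is_Nil_conv)+
  then show False using letter_pigeonhole assms(2) by (metis hd_append2)
qed

text \<open>These squares are themselves overlap-free, so the overlap test alone would not remove
  them from the search.\<close>

definition excluded :: "letter list list" where
  "excluded =
     [[La, La, Lb, La, La, Lb], [Lb, La, La, Lb, La, La], [La, La, Lb, Lb, La, La, Lb, Lb],
      [Lb, Lb, La, Lb, Lb, La], [La, Lb, Lb, La, Lb, Lb], [Lb, Lb, La, La, Lb, Lb, La, La]]"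

lemma instance_not_excluded:
  assumes "is_instance f v"
  shows "v \<notin> set excluded"
proof -
  obtain i where i: "occurs_at i (concat (map f v))" and ne: "f c \<noteq> []" for c
    using assms by (auto simp: is_instance_def)
  note no = no_xxyxxy[of i, OF _ ne ne] no_yxxyxx[of i, OF _ ne ne] no_xxyyxxyy[of i, OF _ ne ne]
  show ?thesis
    using i no[of La Lb] no[of Lb La] by (auto simp: excluded_def)
qed

section \<open>Rich words and short images\<close>

text \<open>A word containing \<open>aa\<close> and \<open>bb\<close> contains \<open>aab\<close> and \<open>abb\<close>, or \<open>bba\<close> and \<open>baa\<close>. Asking for
  these longer factors is what makes the check of short images below conclusive.\<close>

definition rich :: "letter list \<Rightarrow> bool" where
  "rich w \<longleftrightarrow> sublist [La, Lb, La] w \<and> sublist [Lb, La, Lb] w \<and>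
     (sublist [La, La, Lb] w \<and> sublist [La, Lb, Lb] w \<or>
      sublist [Lb, La, La] w \<and> sublist [Lb, Lb, La] w)"

lemma rich_mono: "rich v \<Longrightarrow> sublist v w \<Longrightarrow> rich w"
  unfolding rich_def by (meson sublist_order.order_trans)

text \<open>The two copies of \<open>x\<close> start at positions of different parity, which
  \<open>occurs_at_parity\<close> forbids for five or more letters.\<close>

lemma odd_square_length:
  assumes "occurs_at i (x @ x)" "odd (length x)"
  shows "length x < 5"
  using occurs_at_parity[of i x "i + length x"] assms
  by (cases "5 \<le> length x") (auto simp: occurs_at_append)

lemma xyx_length:
  assumes "occurs_at i (x @ y @ x)" "odd (length x + length y)"
  shows "length x < 5"
  using occurs_at_parity[of i x "i + (length x + length y)"] assms
  by (cases "5 \<le> length x") (auto simp: occurs_at_append add.assoc)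

text \<open>An image of odd length is bounded by its square. An image of even length is bounded by
  its two copies around the other image, whose odd length makes their distance odd.\<close>

lemma rich_instance_length:
  assumes "is_instance f w" "rich w" "odd (length (f c))"
  shows "length (f d) < 5"
proof -
  have occ: "\<exists>k. occurs_at k (concat (map f v))" if "sublist v w" for v
    using is_instance_sublist[OF assms(1) that] by (simp add: is_instance_def)
  have sub: "sublist [La, Lb, La] w" "sublist [Lb, La, Lb] w"
    "sublist [La, La] w" "sublist [Lb, Lb] w"
  proof -
    have *: "sublist [La, La] [La, La, Lb]" "sublist [La, La] [Lb, La, La]"
      "sublist [Lb, Lb] [La, Lb, Lb]" "sublist [Lb, Lb] [Lb, Lb, La]"
      by code_simp+
    show "sublist [La, Lb, La] w" "sublist [Lb, La, Lb] w"
      "sublist [La, La] w" "sublist [Lb, Lb] w"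
      using assms(2) * unfolding rich_def by (meson sublist_order.order_trans)+
  qed
  show ?thesis
  proof (cases "odd (length (f d))")
    case True
    obtain k where "occurs_at k (f d @ f d)"
      using occ[OF sub(3)] occ[OF sub(4)] by (cases d) auto
    then show ?thesis using odd_square_length True by blast
  next
    case False
    then have "d \<noteq> c" using assms(3) by auto
    then obtain k where "occurs_at k (f d @ f c @ f d)"
      using occ[OF sub(1)] occ[OF sub(2)] by (cases c; cases d) auto
    then show ?thesis using xyx_length False assms(3) by auto
  qed
qed

fun words :: "nat \<Rightarrow> letter list list" where
  "words 0 = [[]]"
| "words (Suc n) = map (Cons La) (words n) @ map (Cons Lb) (words n)"

lemma in_words: "w \<in> set (words (length w))"
proof (induction w)
  case (Cons c w)
  then show ?case by (cases c) auto
qed simp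

definition short_words :: "letter list list" where
  "short_words = words 1 @ words 2 @ words 3 @ words 4"

lemma in_short_words:
  assumes "w \<noteq> []" "length w < 5"
  shows "w \<in> set short_words"
proof -
  have "0 < length w" using assms(1) by simp
  then have "length w = 1 \<or> length w = 2 \<or> length w = 3 \<or> length w = 4"
    using assms(2) by arith
  then show ?thesis using in_words[of w] unfolding short_words_def set_append by (metis UnCI)
qed

definition letter_images :: "letter list \<Rightarrow> letter list \<Rightarrow> bool" where
  "letter_images x y \<longleftrightarrow> x = [La] \<and> y = [Lb] \<or> x = [Lb] \<and> y = [La]"

text \<open>Nested conditionals instead of implications, because the simplifier would evaluate all
  premises of an implication.\<close>

lemma short_images_check:
  "list_all (\<lambda>x. list_all (\<lambda>y.
     if odd (length x) \<or> odd (length y) then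
       if overlap_free (x @ y @ x) then
         if overlap_free (y @ x @ y) then
           if overlap_free (x @ x @ y) \<and> overlap_free (x @ y @ y) \<or>
             overlap_free (y @ x @ x) \<and> overlap_free (y @ y @ x)
           then letter_images x y else True
         else True
       else True
     else True) short_words) short_words"
  by code_simp

lemma rich_instance_occurs:
  assumes "is_instance f w" "rich w"
  shows "\<exists>i. occurs_at i w"
proof -
  obtain g where g: "is_instance g w" "\<exists>c. odd (length (g c))"
    using instance_odd[OF assms(1)] by blast
  have ne: "g c \<noteq> []" for c using g(1) by (simp add: is_instance_def)
  have short: "g c \<in> set short_words" for c
    using in_short_words[OF ne] rich_instance_length[OF g(1) assms(2)] g(2) by blast
  have odd_image: "odd (length (g La)) \<or> odd (length (g Lb))"
    using g(2) by (metis letter.exhaust)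
  have "overlap_free (g a @ g b @ g c)" if "sublist [a, b, c] w" for a b c
    using is_instance_sublist[OF g(1) that] occurs_at_overlap_free
    by (auto simp: is_instance_def)
  then have "overlap_free (g La @ g Lb @ g La)" "overlap_free (g Lb @ g La @ g Lb)"
    "overlap_free (g La @ g La @ g Lb) \<and> overlap_free (g La @ g Lb @ g Lb) \<or>
     overlap_free (g Lb @ g La @ g La) \<and> overlap_free (g Lb @ g Lb @ g La)"
    using assms(2) unfolding rich_def by blast+
  moreover note short_images_check[unfolded list_all_iff, THEN bspec, OF short[of La],
      THEN bspec, OF short[of Lb]]
  ultimately have images: "letter_images (g La) (g Lb)"
    using odd_image by (simp only: if_True)
  obtain i where i: "occurs_at i (concat (map g w))"
    using g(1) by (auto simp: is_instance_def)
  from images consider "g La = [La]" "g Lb = [Lb]" | "g La = [Lb]" "g Lb = [La]"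
    by (auto simp: letter_images_def)
  then show ?thesis
  proof cases
    case 1
    then have "g = (\<lambda>c. [c])" by (metis letter.exhaust)
    then show ?thesis using i by auto
  next
    case 2
    then have "g = (\<lambda>c. [flip c])" by (metis letter.exhaust flip.simps)
    \<comment> \<open>Only the complement of \<open>w\<close> has been found; complementing once
      more recovers \<open>w\<close>.\<close>
    then have "occurs_at i (map flip w)" using i by simp
    then obtain k where "occurs_at k (map flip (map flip w))" by (rule occurs_at_flip)
    then show ?thesis by (auto simp: comp_def)
  qed
qed

section \<open>Exhaustive search among the words that are not rich\<close>

definition candidate_step :: "letter list \<Rightarrow> bool" where
  "candidate_step w \<longleftrightarrow>
     \<not> overlap_prefix w \<and> list_all (\<lambda>v. \<not> prefix v w) excluded \<and> \<not> rich w"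

text \<open>Words grow to the left, so a new forbidden factor must be a prefix. Dropping rich words
  is safe because every suffix of a word that is not rich is not rich either.\<close>

fun candidates :: "nat \<Rightarrow> letter list list" where
  "candidates 0 = [[]]"
| "candidates (Suc n) =
     (let cs = candidates n in filter candidate_step (map (Cons La) cs @ map (Cons Lb) cs))"

lemma in_candidates:
  assumes "is_instance f w" "\<not> rich w"
  shows "w \<in> set (candidates (length w))"
  using assms
proof (induction w)
  case (Cons c w)
  have sub: "sublist w (c # w)" by (simp add: sublist_Cons_right)
  have "candidate_step (c # w)"
    unfolding candidate_step_def list_all_iff
    using Cons.prems instance_not_overlap_prefix instance_not_excluded is_instance_sublist
      prefix_imp_sublist by blast
  moreover have "w \<in> set (candidates (length w))"
    using Cons sub is_instance_sublist rich_mono by blast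
  ultimately show ?case by (cases c) (auto simp: Let_def)
qed simp

text \<open>The search dies out here; any longer word is ruled out through its first 11
  letters.\<close>

lemma candidates_11: "candidates 11 = []"
  by code_simp

text \<open>The prefix of length 64 contains every surviving word apart from the two exceptional
  ones.\<close>

lemma candidates_check:
  "list_all (\<lambda>n. list_all (\<lambda>w.
     w = [La, La, Lb, La, La] \<or> w = [Lb, Lb, La, Lb, Lb] \<or>
     sublist w ((mu ^^ 6) [La])) (candidates n)) [0..<11]"
  by code_simp

lemma sublist_mu_power_occurs:
  assumes "sublist w ((mu ^^ n) [La])"
  shows "\<exists>i. occurs_at i w"
proof -
  have "occurs_at 0 ((mu ^^ n) [La])"
    by (simp add: occurs_at_def length_mu_power tm_mu_power)
  then show ?thesis using assms by (auto simp: sublist_def occurs_at_append)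
qed

lemma poor_instance:
  assumes "is_instance f w" "\<not> rich w"
  shows "w = [La, La, Lb, La, La] \<or> w = [Lb, Lb, La, Lb, Lb] \<or> (\<exists>i. occurs_at i w)"
proof -
  have "length w < 11"
  proof (rule ccontr)
    assume long: "\<not> ?thesis"
    have "sublist (take 11 w) w" by (simp add: sublist_take)
    then have "take 11 w \<in> set (candidates (length (take 11 w)))"
      using assms is_instance_sublist rich_mono in_candidates by blast
    then show False using long candidates_11 by simp
  qed
  then have "length w \<in> set [0..<11]" by simp
  then have "w = [La, La, Lb, La, La] \<or> w = [Lb, Lb, La, Lb, Lb] \<or> sublist w ((mu ^^ 6) [La])"
    using candidates_check in_candidates[OF assms] unfolding list_all_iff by blast
  then show ?thesis using sublist_mu_power_occurs by blast
qed

section \<open>The two exceptional words and the equivalence\<close>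

lemma exceptional_instances:
  "is_instance (case_letter [La] [Lb, Lb]) [La, La, Lb, La, La]"
  "is_instance (case_letter [La, La] [Lb]) [Lb, Lb, La, Lb, Lb]"
proof -
  \<comment> \<open>Doubling the middle letter gives aabbaa and bbaabb, both found in the prefix of
    length 32.\<close>
  have "sublist [La, La, Lb, Lb, La, La] ((mu ^^ 5) [La])"
    "sublist [Lb, Lb, La, La, Lb, Lb] ((mu ^^ 5) [La])"
    by code_simp+
  then show "is_instance (case_letter [La] [Lb, Lb]) [La, La, Lb, La, La]"
    "is_instance (case_letter [La, La] [Lb]) [Lb, Lb, La, Lb, Lb]"
    by (auto simp: is_instance_def dest: sublist_mu_power_occurs split: letter.splits)
qed

theorem theorem3p7:
  fixes w :: "letter list"
  assumes "w \<noteq> []"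
  shows "unavoidable w thue_morse \<longleftrightarrow>
    w = [La, La, Lb, La, La] \<or> w = [Lb, Lb, La, Lb, Lb] \<or> segment w thue_morse"
  unfolding unavoidable_iff[OF assms]
proof
  assume "\<exists>f. is_instance f w"
  then show "w = [La, La, Lb, La, La] \<or> w = [Lb, Lb, La, Lb, Lb] \<or> segment w thue_morse"
    using assms rich_instance_occurs poor_instance by (metis segment_iff_occurs_at)
next
  assume "w = [La, La, Lb, La, La] \<or> w = [Lb, Lb, La, Lb, Lb] \<or> segment w thue_morse"
  moreover have "is_instance (\<lambda>c. [c]) w" if "segment w thue_morse"
    using that by (auto simp: is_instance_def segment_iff_occurs_at)
  ultimately show "\<exists>f. is_instance f w"
    using exceptional_instances by metis
qed

end
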